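(* Let $\gamma\in\mathbb{C}\setminus\{0\}$, $0\leq\lambda\leq 1$, $-1\leq B<A\leq 1$, let $n\in\mathbb{N}\setminus\{1\}$ be fixed, and let $f(z)=z+\sum_{j=2}^{\infty}a_jz^j$ belong to $\mathcal{S}(\lambda,\gamma,A,B)$. For $k\in\mathbb{N}$ define $A_k=|\gamma(A-B)-B(k-1)|-(k-1)$. (i) If $A_2\leq 0$, then $$|a_n|\leq\frac{|\gamma|(A-B)}{(n-1)(1+\lambda(n-1))}.$$ (ii) If $A_{n-1}\geq 0$, then $$|a_n|\leq\frac{\prod_{j=0}^{n-2}|\gamma(A-B)-jB|}{(n-1)!\,(1+\lambda(n-1))}.$$ (iii) If $A_k\geq 0$ and $A_{k+1}\leq 0$ for some $k\in\{2,3,\ldots,n-2\}$, then $$|a_n|\leq\frac{\prod_{j=0}^{k-1}|\gamma(A-B)-jB|}{(k-1)!\,(n-1)(1+\lambda(n-1))}.$$ The estimates in (i) and (ii) are sharp.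
   Context: Let $\mathbb{D}=\{z\in\mathbb{C}:|z|<1\}$ and let $\mathcal{A}$ be the family of analytic functions $f$ in $\mathbb{D}$ with $f(0)=0$, $f'(0)=1$. For analytic functions $f,g$ in $\mathbb{D}$, $f\prec g$ ($f$ is subordinate to $g$) means that there is an analytic $\omega:\mathbb{D}\to\mathbb{D}$ with $\omega(0)=0$ and $f(z)=g(\omega(z))$ for $z\in\mathbb{D}$. For $\gamma\in\mathbb{C}\setminus\{0\}$, $0\leq\lambda\leq1$, $-1\leq B<A\leq1$, the class $\mathcal{S}(\lambda,\gamma,A,B)$ consists of all $f\in\mathcal{A}$ such that $$1+\frac{1}{\gamma}\left(\frac{z(\lambda zf'(z)+(1-\lambda)f(z))'}{\lambda zf'(z)+(1-\lambda)f(z)}-1\right)\prec\frac{1+Az}{1+Bz},\quad z\in\mathbb{D}.$$ "Sharp" means that for all parameters and $n$ satisfying the hypothesis of the given part there is a function in the class for which equality holds in the estimate of $|a_n|$. *)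

theory Defs
  imports "HOL-Complex_Analysis.Complex_Analysis"
begin

abbreviation unit_disc :: "complex set" where
  "unit_disc \<equiv> ball 0 1"

definition class_A :: "(complex \<Rightarrow> complex) set" where
  "class_A = {f. f holomorphic_on unit_disc \<and> f 0 = 0 \<and> deriv f 0 = 1}"

definition subordinate :: "(complex \<Rightarrow> complex) \<Rightarrow> (complex \<Rightarrow> complex) \<Rightarrow> bool" where
  "subordinate f g \<longleftrightarrow>
     f holomorphic_on unit_disc \<and> g holomorphic_on unit_disc \<and>
     (\<exists>\<omega>. \<omega> holomorphic_on unit_disc \<and> \<omega> ` unit_disc \<subseteq> unit_disc \<and> \<omega> 0 = 0 \<and>
          (\<forall>z\<in>unit_disc. f z = g (\<omega> z)))"

definition lambda_mean :: "real \<Rightarrow> (complex \<Rightarrow> complex) \<Rightarrow> complex \<Rightarrow> complex" where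
  "lambda_mean lam f z = of_real lam * z * deriv f z + (1 - of_real lam) * f z"

text \<open>
  The quotient \<open>z F'(z) / F(z)\<close>. For \<open>F\<close> with \<open>F 0 = 0\<close> and \<open>F' 0 = 1\<close> it has a removable
  singularity at \<open>0\<close> with value \<open>1\<close>; HOL's \<open>0 / 0 = 0\<close> would give the wrong value there.
\<close>

definition log_deriv_quot :: "(complex \<Rightarrow> complex) \<Rightarrow> complex \<Rightarrow> complex" where
  "log_deriv_quot F z = (if z = 0 then 1 else z * deriv F z / F z)"

text \<open>
  That the quotient is analytic in the disc presupposes that its denominator vanishes only
  at \<open>0\<close>; as division by zero is total in HOL, this is stated explicitly.
\<close>

definition class_S :: "real \<Rightarrow> complex \<Rightarrow> real \<Rightarrow> real \<Rightarrow> (complex \<Rightarrow> complex) set" where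
  "class_S lam \<gamma> A B =
     {f \<in> class_A.
        (\<forall>z\<in>unit_disc - {0}. lambda_mean lam f z \<noteq> 0) \<and>
        subordinate (\<lambda>z. 1 + 1 / \<gamma> * (log_deriv_quot (lambda_mean lam f) z - 1))
                    (\<lambda>z. (1 + of_real A * z) / (1 + of_real B * z))}"

definition taylor_coeff :: "(complex \<Rightarrow> complex) \<Rightarrow> nat \<Rightarrow> complex" where
  "taylor_coeff f n = fps_nth (fps_expansion f 0) n"

definition A_seq :: "complex \<Rightarrow> real \<Rightarrow> real \<Rightarrow> nat \<Rightarrow> real" where
  "A_seq \<gamma> A B k =
     norm (\<gamma> * (of_real A - of_real B) - of_real B * (of_nat k - 1)) - (real k - 1)"

end

theory Submission
  imports Defs
begin

text \<open>
  Put \<open>\<delta> = \<gamma> * (A - B)\<close> and let \<open>F z = lam * z * deriv f z + (1 - lam) * f z\<close>, with coefficients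
  \<open>b n = (1 + lam * (n - 1)) * a n\<close>. Clearing denominators, the subordination says that
  \<open>z * deriv F z - F z = w z * (\<delta> * F z - B * (z * deriv F z - F z))\<close> for a Schwarz function \<open>w\<close>
  (\<open>class_S_iff_schwarz_relation\<close>). Multiplication by \<open>w\<close> shifts coefficients upwards, as \<open>w 0 = 0\<close>,
  and does not increase their sum of squares, as \<open>\<bar>w\<bar> < 1\<close>. Comparing the two sides in this way
  (\<open>schwarz_relation_coeff_inequality\<close>) yields, for every \<open>n\<close>,
  \<open>(n - 1)\<^sup>2 * \<bar>b n\<bar>\<^sup>2 \<le> (\<Sum>k=1..n-1. (\<bar>\<delta> - (k - 1) * B\<bar>\<^sup>2 - (k - 1)\<^sup>2) * \<bar>b k\<bar>\<^sup>2)\<close>.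

  The \<open>k\<close>-th weight has the sign of \<open>A_seq \<gamma> A B k\<close>, and that sequence is nonincreasing because
  \<open>\<bar>B\<bar> \<le> 1\<close>. So the weights are nonnegative up to some index and nonpositive afterwards. On the
  nonnegative stretch the \<open>\<bar>b k\<bar>\<close> are bounded by induction, the extremal case being
  \<open>\<bar>b (j + 1)\<bar> = (\<Prod>i<j. \<bar>\<delta> - i * B\<bar>) / fact j\<close>, for which the weighted sum telescopes; the
  nonpositive terms are dropped (\<open>coeff_bound_of_square_inequality\<close>). The three parts differ only in
  where the sign changes: after the first index, not before \<open>n\<close>, or in between.

  For sharpness, the Schwarz functions \<open>z\<close> and \<open>z ^ (n - 1)\<close> are used
  (\<open>class_S_extremal_exists\<close>): the relation is then a first-order differential equation whose solution
  is \<open>z\<close> times an exponential, hence has no zero but the origin, and the coefficients of this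
  solution satisfy an explicit two-term recursion.
\<close>

section \<open>Coefficients of a function dominated by a polynomial\<close>

lemma roots_of_unity_orthogonal:
  fixes k l M :: nat
  assumes "k < M" "l < M"
  shows "(\<Sum>j<M. cis (2 * pi * real j / real M) ^ k * cnj (cis (2 * pi * real j / real M) ^ l))
           = (if k = l then of_nat M else 0)"
proof -
  define u where "u = cis (2 * pi * real k / real M) * cnj (cis (2 * pi * real l / real M))"
  have M: "M > 0" using assms by simp
  have swap: "cis (2 * pi * real j / real M) ^ i = cis (2 * pi * real i / real M) ^ j" for i j
    by (simp only: Complex.DeMoivre) (simp add: ac_simps)
  have "(\<Sum>j<M. cis (2 * pi * real j / real M) ^ k * cnj (cis (2 * pi * real j / real M) ^ l))
          = (\<Sum>j<M. u ^ j)"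
    by (intro sum.cong refl) (simp only: swap[of _ k] swap[of _ l] u_def power_mult_distrib complex_cnj_power)
  also have "\<dots> = (if k = l then of_nat M else 0)"
  proof (cases "k = l")
    case True
    then have "u = 1" by (simp add: u_def cis_cnj cis_mult)
    then show ?thesis using True by simp
  next
    case False
    have "cis (2 * pi * real k / real M) \<noteq> cis (2 * pi * real l / real M)"
      using Complex.bij_betw_roots_unity[OF M] assms False
      unfolding bij_betw_def by (meson inj_onD lessThan_iff)
    moreover have "u * cis (2 * pi * real l / real M) = cis (2 * pi * real k / real M)"
      by (simp add: u_def cis_cnj cis_mult)
    ultimately have "u \<noteq> 1" by auto
    moreover have "u ^ M = 1"
    proof -
      have "cis (2 * pi * real i / real M) ^ M = 1" for i
        using M by (simp add: Complex.DeMoivre cis_multiple_2pi)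
      then show ?thesis by (simp add: u_def power_mult_distrib flip: complex_cnj_power)
    qed
    ultimately show ?thesis using False by (simp add: geometric_sum)
  qed
  finally show ?thesis .
qed

text \<open>
  Averaging over \<open>M\<close> equally spaced points of a circle is already exact for polynomials of degree
  less than \<open>M\<close>, so Parseval's identity becomes a finite computation without integrals.
\<close>

lemma parseval_roots_of_unity:
  fixes c :: "nat \<Rightarrow> complex" and r :: real
  assumes "n \<le> M" "0 \<le> r"
  shows "(\<Sum>j<M. (norm (\<Sum>k<n. c k * (of_real r * cis (2 * pi * real j / real M)) ^ k))\<^sup>2)
           = real M * (\<Sum>k<n. (norm (c k))\<^sup>2 * r ^ (2 * k))"
proof -
  define \<zeta> where "\<zeta> = (\<lambda>j. cis (2 * pi * real j / real M))"
  define d where "d = (\<lambda>k. c k * of_real r ^ k)"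
  have "complex_of_real (\<Sum>j<M. (norm (\<Sum>k<n. d k * \<zeta> j ^ k))\<^sup>2)
          = (\<Sum>j<M. \<Sum>k<n. \<Sum>l<n. d k * \<zeta> j ^ k * cnj (d l * \<zeta> j ^ l))"
    by (simp only: of_real_sum complex_norm_square cnj_sum sum_product)
  also have "\<dots> = (\<Sum>k<n. \<Sum>j<M. \<Sum>l<n. d k * \<zeta> j ^ k * cnj (d l * \<zeta> j ^ l))"
    by (rule sum.swap)
  also have "\<dots> = (\<Sum>k<n. \<Sum>l<n. \<Sum>j<M. d k * \<zeta> j ^ k * cnj (d l * \<zeta> j ^ l))"
    by (rule sum.cong[OF refl sum.swap])
  also have "\<dots> = (\<Sum>k<n. \<Sum>l<n. d k * cnj (d l) * (\<Sum>j<M. \<zeta> j ^ k * cnj (\<zeta> j ^ l)))"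
    by (simp add: sum_distrib_left mult_ac)
  also have "\<dots> = (\<Sum>k<n. \<Sum>l<n. if k = l then d k * cnj (d l) * of_nat M else 0)"
    unfolding \<zeta>_def using assms by (intro sum.cong refl) (subst roots_of_unity_orthogonal, auto)
  also have "\<dots> = (\<Sum>k<n. d k * cnj (d k) * of_nat M)"
    by simp
  also have "\<dots> = complex_of_real (real M * (\<Sum>k<n. (norm (d k))\<^sup>2))"
    by (simp only: of_real_mult of_real_sum complex_norm_square sum_distrib_left of_real_of_nat_eq mult_ac)
  finally have "(\<Sum>j<M. (norm (\<Sum>k<n. d k * \<zeta> j ^ k))\<^sup>2) = real M * (\<Sum>k<n. (norm (d k))\<^sup>2)"
    using of_real_eq_iff by blast
  then show ?thesis
    using assms(2)
    by (simp add: d_def \<zeta>_def norm_mult norm_power power_mult_distrib mult_ac flip: power_mult)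
qed

text \<open>
  Integrating \<open>\<bar>g\<bar>\<^sup>2 \<le> \<bar>p\<bar>\<^sup>2\<close> over the circle of radius \<open>r\<close>, where \<open>p\<close> is the polynomial
  with coefficients \<open>c\<close>, compares the two sums weighted by \<open>r ^ (2 * k)\<close>; then \<open>r\<close> tends to \<open>1\<close>.
  The integral is replaced by an average over \<open>M\<close> points and \<open>g\<close> by its Taylor polynomial of
  degree less than \<open>M\<close>, which is uniformly close to \<open>g\<close> on that circle for large \<open>M\<close>.
\<close>

lemma coeff_sum_le_of_norm_le_polynomial:
  fixes g :: "complex \<Rightarrow> complex" and G :: "complex fps" and c :: "nat \<Rightarrow> complex"
  assumes hol: "g holomorphic_on ball 0 1" and G: "g has_fps_expansion G"
    and le: "\<And>z. norm z < 1 \<Longrightarrow> norm (g z) \<le> norm (\<Sum>k<n. c k * z ^ k)"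
  shows "(\<Sum>k<N. (norm (fps_nth G k))\<^sup>2) \<le> (\<Sum>k<n. (norm (c k))\<^sup>2)"
proof -
  have sums: "(\<lambda>k. fps_nth G k * z ^ k) sums g z" if "norm z < 1" for z
    using has_fps_expansion_imp_sums_complex[OF G, of 1 z] hol that by (simp add: one_ereal_def)
  have circle: "(\<Sum>k<N. (norm (fps_nth G k))\<^sup>2 * r ^ (2 * k)) \<le> (\<Sum>k<n. (norm (c k))\<^sup>2 * r ^ (2 * k))"
    if r: "0 < r" "r < 1" for r :: real
  proof (rule field_le_epsilon)
    fix e :: real assume e: "e > 0"
    define C where "C = (\<Sum>k<n. norm (c k))"
    have C: "C \<ge> 0" by (simp add: C_def sum_nonneg)
    \<comment> \<open>Adding \<open>\<epsilon>\<close> to a number in \<open>[0, C]\<close> increases its square by at most \<open>\<epsilon> * (2 * C + 1) \<le> e\<close>.\<close>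
    define \<epsilon> where "\<epsilon> = min 1 (e / (2 * C + 1))"
    have \<epsilon>: "\<epsilon> > 0" "\<epsilon> \<le> 1" "\<epsilon> * (2 * C + 1) \<le> e"
      using e C by (simp_all add: \<epsilon>_def flip: pos_le_divide_eq)
    have "uniform_limit (sphere 0 r) (\<lambda>m z. \<Sum>k<m. fps_nth G k * z ^ k)
             (\<lambda>z. \<Sum>k. fps_nth G k * z ^ k) sequentially"
    proof (rule Weierstrass_m_test)
      show "norm (fps_nth G k * z ^ k) \<le> norm (fps_nth G k * of_real r ^ k)" if "z \<in> sphere 0 r" for k z
        using that r by (simp add: norm_mult norm_power)
      obtain r' where r': "r < r'" "r' < 1" using dense r by blast
      show "summable (\<lambda>k. norm (fps_nth G k * of_real r ^ k))"
        using powser_insidea[OF sums_summable[OF sums[of "of_real r'"]], of "of_real r"] r r' by simp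
    qed
    then have "\<forall>\<^sub>F m in sequentially. \<forall>z\<in>sphere 0 r.
                 dist (\<Sum>k<m. fps_nth G k * z ^ k) (\<Sum>k. fps_nth G k * z ^ k) < \<epsilon>"
      using \<epsilon>(1) by (rule uniform_limitD)
    then have "\<forall>\<^sub>F m in sequentially. N \<le> m \<and> n \<le> m \<and> 0 < m \<and> (\<forall>z\<in>sphere 0 r.
                 dist (\<Sum>k<m. fps_nth G k * z ^ k) (\<Sum>k. fps_nth G k * z ^ k) < \<epsilon>)"
      by (intro eventually_conj eventually_ge_at_top eventually_gt_at_top)
    then obtain M where M: "N \<le> M" "n \<le> M" "0 < M"
      and close: "\<And>z. z \<in> sphere 0 r \<Longrightarrow>
                 dist (\<Sum>k<M. fps_nth G k * z ^ k) (\<Sum>k. fps_nth G k * z ^ k) < \<epsilon>"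
      using eventually_happens'[OF trivial_limit_sequentially] by blast
    have pt: "(norm (\<Sum>k<M. fps_nth G k * z ^ k))\<^sup>2 \<le> (norm (\<Sum>k<n. c k * z ^ k))\<^sup>2 + e"
      if z: "norm z = r" for z
    proof -
      define a where "a = norm (\<Sum>k<n. c k * z ^ k)"
      have a: "0 \<le> a" by (simp add: a_def)
      have "a \<le> (\<Sum>k<n. norm (c k * z ^ k))" unfolding a_def by (rule norm_sum)
      also have "\<dots> \<le> C" unfolding C_def
        using r z by (intro sum_mono) (simp add: norm_mult norm_power mult_left_le power_le_one)
      finally have aC: "a \<le> C" .
      have "norm (\<Sum>k<M. fps_nth G k * z ^ k) \<le> norm (g z) + \<epsilon>"
      proof -
        have "(\<Sum>k. fps_nth G k * z ^ k) = g z" using sums z r by (simp add: sums_iff)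
        then have "norm ((\<Sum>k<M. fps_nth G k * z ^ k) - g z) < \<epsilon>"
          using close[of z] z by (simp add: dist_norm)
        then show ?thesis using norm_triangle_sub[of "\<Sum>k<M. fps_nth G k * z ^ k" "g z"] by linarith
      qed
      also have "\<dots> \<le> a + \<epsilon>" using le[of z] z r by (simp add: a_def)
      finally have "(norm (\<Sum>k<M. fps_nth G k * z ^ k))\<^sup>2 \<le> (a + \<epsilon>)\<^sup>2"
        by (intro power_mono) auto
      also have "\<dots> = a\<^sup>2 + \<epsilon> * (2 * a + \<epsilon>)" by (simp add: power2_eq_square algebra_simps)
      also have "\<epsilon> * (2 * a + \<epsilon>) \<le> \<epsilon> * (2 * C + 1)"
        using aC \<epsilon> by (intro mult_left_mono) auto
      finally show ?thesis using \<epsilon>(3) by (simp add: a_def)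
    qed
    have "real M * (\<Sum>k<N. (norm (fps_nth G k))\<^sup>2 * r ^ (2 * k))
            \<le> real M * (\<Sum>k<M. (norm (fps_nth G k))\<^sup>2 * r ^ (2 * k))"
      using M r by (intro mult_left_mono sum_mono2) auto
    also have "\<dots> = (\<Sum>j<M. (norm (\<Sum>k<M. fps_nth G k * (of_real r * cis (2 * pi * real j / real M)) ^ k))\<^sup>2)"
      by (rule parseval_roots_of_unity[symmetric]) (use r in auto)
    also have "\<dots> \<le> (\<Sum>j<M. (norm (\<Sum>k<n. c k * (of_real r * cis (2 * pi * real j / real M)) ^ k))\<^sup>2 + e)"
      using r by (intro sum_mono pt) (simp add: norm_mult)
    also have "\<dots> = real M * ((\<Sum>k<n. (norm (c k))\<^sup>2 * r ^ (2 * k)) + e)"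
      using parseval_roots_of_unity[OF M(2), of r c] r by (simp add: sum.distrib algebra_simps)
    finally show "(\<Sum>k<N. (norm (fps_nth G k))\<^sup>2 * r ^ (2 * k))
                    \<le> (\<Sum>k<n. (norm (c k))\<^sup>2 * r ^ (2 * k)) + e"
      using M(3) by (simp add: mult_le_cancel_left)
  qed
  show ?thesis
  proof (rule tendsto_le[OF trivial_limit_at_left_real[of 1]])
    show "((\<lambda>r. \<Sum>k<n. (norm (c k))\<^sup>2 * r ^ (2 * k)) \<longlongrightarrow> (\<Sum>k<n. (norm (c k))\<^sup>2)) (at_left (1::real))"
      by (rule tendsto_eq_intros refl | simp)+
    show "((\<lambda>r. \<Sum>k<N. (norm (fps_nth G k))\<^sup>2 * r ^ (2 * k)) \<longlongrightarrow> (\<Sum>k<N. (norm (fps_nth G k))\<^sup>2)) (at_left (1::real))"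
      by (rule tendsto_eq_intros refl | simp)+
    show "\<forall>\<^sub>F r in at_left (1::real). (\<Sum>k<N. (norm (fps_nth G k))\<^sup>2 * r ^ (2 * k))
             \<le> (\<Sum>k<n. (norm (c k))\<^sup>2 * r ^ (2 * k))"
      using eventually_at_left_real[OF zero_less_one] by eventually_elim (auto intro: circle)
  qed
qed

section \<open>The coefficient inequality of Clunie and Robertson\<close>

text \<open>
  This turns the functional relation into a recursion: the left side has coefficients
  \<open>(k - 1) * b k\<close> and the second factor on the right has \<open>(\<delta> - (k - 1) * B) * b k\<close>.
\<close>

lemma schwarz_relation_fps:
  fixes w F :: "complex \<Rightarrow> complex" and FF W :: "complex fps" and \<delta> B :: complex
  assumes F: "F has_fps_expansion FF" and w: "w has_fps_expansion W"
    and rel: "\<And>z. z \<in> ball 0 1 \<Longrightarrow>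
        z * deriv F z - F z = w z * (\<delta> * F z - B * (z * deriv F z - F z))"
  shows "fps_X * fps_deriv FF - FF
           = W * (fps_const \<delta> * FF - fps_const B * (fps_X * fps_deriv FF - FF))" (is "?D = ?R")
proof -
  have D: "(\<lambda>z. z * deriv F z - F z) has_fps_expansion ?D"
    by (intro fps_expansion_intros F)
  have "(\<lambda>z. w z * (\<delta> * F z - B * (z * deriv F z - F z))) has_fps_expansion ?R"
    by (intro fps_expansion_intros F w D)
  moreover have "eventually (\<lambda>z. z \<in> ball 0 1) (nhds (0::complex))"
    by (intro eventually_nhds_in_open) auto
  then have "eventually (\<lambda>z. w z * (\<delta> * F z - B * (z * deriv F z - F z)) = z * deriv F z - F z) (nhds 0)"
    by eventually_elim (rule rel[symmetric])
  ultimately have "(\<lambda>z. z * deriv F z - F z) has_fps_expansion ?R"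
    by (rule has_fps_expansion_cong[THEN iffD1, OF _ refl, rotated])
  then show ?thesis
    using D fps_expansion_unique_complex by blast
qed

text \<open>
  In \<open>D = W * H\<close> the factor \<open>W\<close> has no constant term, so the coefficients of \<open>D\<close> up to index
  \<open>Suc n\<close> do not change when \<open>H\<close> is cut off above index \<open>n\<close>. The product of \<open>w\<close> with the
  resulting polynomial is dominated by that polynomial because \<open>\<bar>w\<bar> < 1\<close>, so the sum of the squared
  coefficients of \<open>D\<close> up to \<open>Suc n\<close> is at most that of \<open>H\<close> up to \<open>n\<close>. Moving all terms but the
  last to the right gives the inequality.
\<close>

lemma schwarz_relation_coeff_inequality:
  fixes w F :: "complex \<Rightarrow> complex" and \<delta> B :: complex and n :: nat
  defines "b \<equiv> fps_nth (fps_expansion F 0)"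
  assumes w: "w holomorphic_on ball 0 1" "w ` ball 0 1 \<subseteq> ball 0 1" "w 0 = 0"
    and F: "F holomorphic_on ball 0 1" "F 0 = 0"
    and rel: "\<And>z. z \<in> ball 0 1 \<Longrightarrow>
        z * deriv F z - F z = w z * (\<delta> * F z - B * (z * deriv F z - F z))"
  shows "(real n * norm (b (Suc n)))\<^sup>2
           \<le> (\<Sum>j<n. ((norm (\<delta> - of_nat j * B))\<^sup>2 - (real j)\<^sup>2) * (norm (b (Suc j)))\<^sup>2)"
proof -
  define FF where "FF = fps_expansion F 0"
  define W where "W = fps_expansion w 0"
  define D where "D = fps_X * fps_deriv FF - FF"
  define H where "H = fps_const \<delta> * FF - fps_const B * D"
  have F_exp: "F has_fps_expansion FF" and w_exp: "w has_fps_expansion W"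
    unfolding FF_def W_def using F w by (auto intro!: has_fps_expansion_fps_expansion[of "ball 0 1"])
  have W0: "fps_nth W 0 = 0"
    using has_fps_expansion_imp_0_eq_fps_nth_0[OF w_exp] w by simp
  have b0: "b 0 = 0"
    using has_fps_expansion_imp_0_eq_fps_nth_0[OF F_exp] F by (simp add: b_def FF_def)
  have DWH: "D = W * H"
    unfolding H_def D_def by (rule schwarz_relation_fps[OF F_exp w_exp rel])
  have Dk: "fps_nth D k = (of_nat k - 1) * b k" for k
    by (cases k) (simp_all add: D_def b_def FF_def algebra_simps)
  have Hk: "fps_nth H k = (\<delta> - (of_nat k - 1) * B) * b k" for k
    by (simp add: H_def Dk) (simp add: b_def FF_def algebra_simps)

  define P where "P = fps_cutoff (Suc n) H"
  have P_exp: "(\<lambda>z. \<Sum>k<Suc n. fps_nth H k * z ^ k) has_fps_expansion P"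
  proof -
    have "P = (\<Sum>k<Suc n. fps_const (fps_nth H k) * fps_X ^ k)"
      by (rule fps_ext) (simp add: P_def fps_sum_nth if_distrib[of "(*) _"] cong: if_cong)
    then show ?thesis by (auto intro!: fps_expansion_intros)
  qed
  have WP: "fps_nth (W * P) k = fps_nth D k" if "k \<le> Suc n" for k
  proof -
    have eq: "fps_nth W i * fps_nth P (k - i) = fps_nth W i * fps_nth H (k - i)" for i
      using that W0 by (cases i) (auto simp: P_def)
    show ?thesis by (simp only: DWH fps_mult_nth eq)
  qed
  have "(\<Sum>k<Suc (Suc n). (norm (fps_nth (W * P) k))\<^sup>2) \<le> (\<Sum>k<Suc n. (norm (fps_nth H k))\<^sup>2)"
  proof (rule coeff_sum_le_of_norm_le_polynomial)
    show "(\<lambda>z. w z * (\<Sum>k<Suc n. fps_nth H k * z ^ k)) holomorphic_on ball 0 1"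
      by (intro holomorphic_intros w)
    show "(\<lambda>z. w z * (\<Sum>k<Suc n. fps_nth H k * z ^ k)) has_fps_expansion W * P"
      by (intro fps_expansion_intros w_exp P_exp)
    show "norm (w z * (\<Sum>k<Suc n. fps_nth H k * z ^ k)) \<le> norm (\<Sum>k<Suc n. fps_nth H k * z ^ k)"
      if "norm z < 1" for z
      using w(2) that unfolding norm_mult by (intro mult_left_le_one_le) (auto simp: image_subset_iff intro: less_imp_le)
  qed
  also have "(\<Sum>k<Suc (Suc n). (norm (fps_nth (W * P) k))\<^sup>2) = (\<Sum>k<Suc (Suc n). (norm (fps_nth D k))\<^sup>2)"
    by (intro sum.cong refl) (simp add: WP)
  finally have "(\<Sum>k<Suc (Suc n). (norm (fps_nth D k))\<^sup>2) \<le> (\<Sum>k<Suc n. (norm (fps_nth H k))\<^sup>2)" .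
  then have "(\<Sum>j<Suc n. (norm (of_nat j * b (Suc j)))\<^sup>2)
               \<le> (\<Sum>j<n. (norm ((\<delta> - of_nat j * B) * b (Suc j)))\<^sup>2)"
    by (simp only: sum.lessThan_Suc_shift[of _ "Suc n"] sum.lessThan_Suc_shift[of _ n] Dk Hk b0)
       (simp del: sum.lessThan_Suc)
  then show ?thesis
    by (simp add: norm_mult power_mult_distrib sum_subtractf left_diff_distrib[where 'a = real])
qed

section \<open>Solving the recursive inequality\<close>

text \<open>
  The numbers \<open>(\<Prod>i<j. e i) / fact j\<close> are those for which the recursive inequality of the next
  lemma is an equality at every index.
\<close>

lemma sum_prod_over_fact_telescope:
  fixes e :: "nat \<Rightarrow> real"
  assumes "1 \<le> k"
  shows "(\<Sum>j<k. ((e j)\<^sup>2 - (real j)\<^sup>2) * ((\<Prod>i<j. e i) / fact j)\<^sup>2)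
           = ((\<Prod>i<k. e i) / fact (k - 1))\<^sup>2"
  using assms
proof (induction k rule: dec_induct)
  case base
  then show ?case by simp
next
  case (step k)
  define p where "p = (\<Prod>i<k. e i) / fact k"
  have "(\<Prod>i<k. e i) / fact (k - 1) = real k * p"
    using step.hyps by (cases k) (simp_all add: p_def)
  then have "(\<Sum>j<Suc k. ((e j)\<^sup>2 - (real j)\<^sup>2) * ((\<Prod>i<j. e i) / fact j)\<^sup>2)
               = (real k * p)\<^sup>2 + ((e k)\<^sup>2 - (real k)\<^sup>2) * p\<^sup>2"
    using step.IH by (simp add: p_def)
  also have "\<dots> = (e k * p)\<^sup>2"
    by (simp add: power_mult_distrib algebra_simps)
  also have "e k * p = (\<Prod>i<Suc k. e i) / fact (Suc k - 1)"
    by (simp add: p_def)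
  finally show ?case .
qed

text \<open>
  The weight \<open>(e j)\<^sup>2 - (real j)\<^sup>2\<close> is nonnegative for \<open>j < k\<close>, so there every \<open>y j\<close> may be replaced
  by an upper bound, and induction shows that \<open>y\<close> stays below the equality case. For \<open>k \<le> j < n\<close>
  the weight is nonpositive and the terms are dropped, which freezes the sum at its value for \<open>k\<close>.
\<close>

lemma coeff_bound_of_square_inequality:
  fixes e y :: "nat \<Rightarrow> real" and k n :: nat
  assumes y: "y 0 = 1" "\<And>j. 0 \<le> y j" and e: "\<And>j. 0 \<le> e j"
    and sq: "\<And>i. (real i * y i)\<^sup>2 \<le> (\<Sum>j<i. ((e j)\<^sup>2 - (real j)\<^sup>2) * (y j)\<^sup>2)"
    and k: "1 \<le> k" "k \<le> n"
    and above: "\<And>j. j < k \<Longrightarrow> real j \<le> e j" and below: "\<And>j. k \<le> j \<Longrightarrow> j < n \<Longrightarrow> e j \<le> real j"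
  shows "real n * y n \<le> (\<Prod>j<k. e j) / fact (k - 1)"
proof -
  have partial: "(\<Sum>j<i. ((e j)\<^sup>2 - (real j)\<^sup>2) * (y j)\<^sup>2) \<le> ((\<Prod>j<i. e j) / fact (i - 1))\<^sup>2"
    if "1 \<le> i" "i \<le> k" and IH: "\<And>j. j < i \<Longrightarrow> y j \<le> (\<Prod>l<j. e l) / fact j" for i
    unfolding sum_prod_over_fact_telescope[OF that(1), symmetric]
    using that(2) y e above by (intro sum_mono mult_left_mono power_mono IH) (auto intro!: power_mono)
  have bound: "y i \<le> (\<Prod>j<i. e j) / fact i" if "i < k" for i
    using that
  proof (induction i rule: less_induct)
    case (less i)
    show ?case
    proof (cases i)
      case 0
      then show ?thesis using y by simp
    next
      case (Suc m)
      have "(real i * y i)\<^sup>2 \<le> ((\<Prod>j<i. e j) / fact (i - 1))\<^sup>2"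
        using sq[of i] partial[of i] less Suc by fastforce
      then have "real i * y i \<le> (\<Prod>j<i. e j) / fact (i - 1)"
        by (rule power2_le_imp_le) (simp add: prod_nonneg e)
      then show ?thesis using Suc by (simp add: pos_le_divide_eq mult_ac)
    qed
  qed
  have "(real n * y n)\<^sup>2 \<le> (\<Sum>j<n. ((e j)\<^sup>2 - (real j)\<^sup>2) * (y j)\<^sup>2)"
    by (rule sq)
  also have "\<dots> \<le> (\<Sum>j<k. ((e j)\<^sup>2 - (real j)\<^sup>2) * (y j)\<^sup>2)"
  proof -
    have "(\<Sum>j\<in>{..<n} - {..<k}. ((e j)\<^sup>2 - (real j)\<^sup>2) * (y j)\<^sup>2) \<le> 0"
      using e below by (intro sum_nonpos mult_nonpos_nonneg) (auto intro!: power_mono)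
    then show ?thesis using k by (subst sum.subset_diff[of "{..<k}"]) auto
  qed
  also have "\<dots> \<le> ((\<Prod>j<k. e j) / fact (k - 1))\<^sup>2"
    using partial[of k] k bound by simp
  finally show ?thesis
    by (rule power2_le_imp_le) (simp add: prod_nonneg e)
qed

section \<open>The class in terms of a Schwarz function\<close>

lemma one_plus_mult_nonzero:
  fixes w :: complex and B :: real
  assumes "norm w < 1" "\<bar>B\<bar> \<le> 1"
  shows "1 + of_real B * w \<noteq> 0"
proof
  assume "1 + of_real B * w = 0"
  then have "of_real B * w = - 1" by (simp add: add_eq_0_iff)
  then have "\<bar>B\<bar> * norm w = 1" by (metis norm_minus_cancel norm_mult norm_of_real norm_one)
  moreover have "\<bar>B\<bar> * norm w \<le> norm w" using assms by (simp add: mult_left_le_one_le)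
  ultimately show False using assms by simp
qed

lemma moebius_quotient_iff_linear:
  fixes F P w a b c :: "'a :: field"
  assumes "F \<noteq> 0" "c \<noteq> 0" "1 + b * w \<noteq> 0"
  shows "1 + 1 / c * (P / F - 1) = (1 + a * w) / (1 + b * w)
           \<longleftrightarrow> P - F = w * (c * (a - b) * F - b * (P - F))"
proof -
  have "1 + 1 / c * (P / F - 1) = (c * F + (P - F)) / (c * F)"
    using assms by (simp add: field_simps)
  then have "1 + 1 / c * (P / F - 1) = (1 + a * w) / (1 + b * w)
               \<longleftrightarrow> (c * F + (P - F)) * (1 + b * w) = (1 + a * w) * (c * F)"
    using assms by (simp add: frac_eq_eq)
  also have "\<dots> \<longleftrightarrow> (c * F + (P - F)) * (1 + b * w) - (1 + a * w) * (c * F) = 0"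
    by simp
  also have "(c * F + (P - F)) * (1 + b * w) - (1 + a * w) * (c * F)
               = (P - F) - w * (c * (a - b) * F - b * (P - F))"
    by (simp add: algebra_simps)
  finally show ?thesis by simp
qed

lemma lambda_mean_holomorphic:
  assumes "f holomorphic_on ball 0 1"
  shows "lambda_mean lam f holomorphic_on ball 0 1"
proof -
  have "(\<lambda>z. of_real lam * z * deriv f z + (1 - of_real lam) * f z) holomorphic_on ball 0 1"
    by (intro holomorphic_intros assms open_ball)
  then show ?thesis by (simp add: lambda_mean_def[abs_def])
qed

text \<open>
  Clearing denominators in the subordination gives a relation that is linear in \<open>F\<close> and its
  derivative, and makes sense at the origin as well. In the other direction, analyticity of the
  subordinate function comes for free, since it is the composition of the Moebius map with \<open>w\<close>.
\<close>

lemma class_S_iff_schwarz_relation: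
  fixes \<gamma> :: complex and lam A B :: real and f :: "complex \<Rightarrow> complex"
  defines "F \<equiv> lambda_mean lam f"
  assumes "\<gamma> \<noteq> 0" "-1 \<le> B" "B < A" "A \<le> 1" and f: "f \<in> class_A"
  shows "f \<in> class_S lam \<gamma> A B \<longleftrightarrow>
     (\<forall>z\<in>unit_disc - {0}. F z \<noteq> 0) \<and>
     (\<exists>w. w holomorphic_on unit_disc \<and> w ` unit_disc \<subseteq> unit_disc \<and> w 0 = 0 \<and>
        (\<forall>z\<in>unit_disc. z * deriv F z - F z
           = w z * (\<gamma> * (of_real A - of_real B) * F z - of_real B * (z * deriv F z - F z))))"
proof -
  define g where "g = (\<lambda>z. (1 + of_real A * z) / (1 + of_real B * z) :: complex)"
  define p where "p = (\<lambda>z. 1 + 1 / \<gamma> * (log_deriv_quot F z - 1))"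
  have B: "\<bar>B\<bar> \<le> 1" using assms by auto
  have F0: "F 0 = 0" using f by (simp add: F_def lambda_mean_def class_A_def)
  have g_hol: "g holomorphic_on unit_disc"
    unfolding g_def by (intro holomorphic_intros one_plus_mult_nonzero B) auto
  have pointwise: "p z = g (w z) \<longleftrightarrow> z * deriv F z - F z
           = w z * (\<gamma> * (of_real A - of_real B) * F z - of_real B * (z * deriv F z - F z))"
    if nz: "\<forall>z\<in>unit_disc - {0}. F z \<noteq> 0" and w: "w ` unit_disc \<subseteq> unit_disc" "w 0 = 0"
      and z: "z \<in> unit_disc" for w z
  proof (cases "z = 0")
    case True
    then show ?thesis using w F0 by (simp add: p_def g_def log_deriv_quot_def)
  next
    case False
    have "norm (w z) < 1" using w(1) z by (auto simp: image_subset_iff)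
    then show ?thesis
      using moebius_quotient_iff_linear[of "F z" \<gamma> "of_real B" "w z" "z * deriv F z" "of_real A"]
        one_plus_mult_nonzero[of "w z" B] nz z False B \<open>\<gamma> \<noteq> 0\<close>
      by (simp add: p_def g_def log_deriv_quot_def)
  qed
  have p_hol: "p holomorphic_on unit_disc"
    if "w holomorphic_on unit_disc" "w ` unit_disc \<subseteq> unit_disc" "\<forall>z\<in>unit_disc. p z = g (w z)" for w
  proof -
    have "(g \<circ> w) holomorphic_on unit_disc"
      using that(1) g_hol that(2) by (rule holomorphic_on_compose_gen)
    then show ?thesis
      by (rule holomorphic_transform) (use that(3) in auto)
  qed
  have "f \<in> class_S lam \<gamma> A B \<longleftrightarrow> (\<forall>z\<in>unit_disc - {0}. F z \<noteq> 0) \<and> subordinate p g"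
    using f by (simp add: class_S_def p_def g_def F_def)
  also have "subordinate p g \<longleftrightarrow>
      (\<exists>w. w holomorphic_on unit_disc \<and> w ` unit_disc \<subseteq> unit_disc \<and> w 0 = 0 \<and>
         (\<forall>z\<in>unit_disc. p z = g (w z)))"
    unfolding subordinate_def using p_hol g_hol by blast
  finally show ?thesis
    by (simp only:) (intro conj_cong refl ex_cong1 ball_cong pointwise)
qed

lemma lambda_mean_taylor_coeff:
  assumes "f holomorphic_on ball 0 1"
  shows "taylor_coeff (lambda_mean lam f) (Suc n) = of_real (1 + lam * real n) * taylor_coeff f (Suc n)"
proof -
  have f: "f has_fps_expansion fps_expansion f 0"
    using assms by (auto intro!: has_fps_expansion_fps_expansion[of "ball 0 1"])
  have "(\<lambda>z. of_real lam * (z * deriv f z) + (1 - of_real lam) * f z) has_fps_expansion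
          fps_const (of_real lam) * (fps_X * fps_deriv (fps_expansion f 0))
            + fps_const (1 - of_real lam) * fps_expansion f 0"
    by (intro fps_expansion_intros f)
  then have "fps_expansion (lambda_mean lam f) 0 =
          fps_const (of_real lam) * (fps_X * fps_deriv (fps_expansion f 0))
            + fps_const (1 - of_real lam) * fps_expansion f 0"
    by (intro fps_expansion_eqI) (simp add: lambda_mean_def[abs_def] mult.assoc)
  then show ?thesis
    by (simp add: taylor_coeff_def algebra_simps)
qed

text \<open>
  The \<open>n\<close>-th coefficient of the \<open>lam\<close>-mean is \<open>1 + lam * (n - 1)\<close> times that of the function.
  Dividing by this number, which is at least \<open>1\<close> for \<open>n \<ge> 1\<close>, does not decrease the radius of convergence.
\<close>

lemma lambda_mean_surjective:
  assumes F: "F holomorphic_on ball 0 1" "F 0 = 0" "deriv F 0 = 1" and lam: "0 \<le> lam"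
  shows "\<exists>f\<in>class_A. \<forall>z\<in>ball 0 1. lambda_mean lam f z = F z"
proof -
  define b where "b = fps_nth (fps_expansion F 0)"
  \<comment> \<open>At index \<open>0\<close> the divisor is \<open>1 - lam\<close>, which may vanish; this is harmless as \<open>b 0 = 0\<close>.\<close>
  define f_fps where "f_fps = Abs_fps (\<lambda>k. b k / of_real (1 + lam * (real k - 1)))"
  define f where "f = eval_fps f_fps"
  have F_exp: "F has_fps_expansion fps_expansion F 0"
    using F by (auto intro!: has_fps_expansion_fps_expansion[of "ball 0 1"])
  have b0: "b 0 = 0" and b1: "b 1 = 1"
    using F by (simp_all add: b_def fps_expansion_def)
  have den: "1 + lam * real k \<ge> 1" for k using lam by simp
  have f_le: "norm (fps_nth f_fps k) \<le> norm (b k)" for k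
  proof (cases k)
    case 0
    then show ?thesis by (simp add: f_fps_def b0)
  next
    case (Suc m)
    have "norm (b k) / (1 + lam * real m) \<le> norm (b k) / 1"
      using den[of m] by (intro divide_left_mono) auto
    moreover have "norm (fps_nth f_fps k) = norm (b k) / (1 + lam * real m)"
      using den[of m] unfolding Suc by (simp only: f_fps_def fps_nth_Abs_fps norm_divide norm_of_real) simp
    ultimately show ?thesis by simp
  qed
  have "fps_conv_radius f_fps \<ge> 1"
    unfolding fps_conv_radius_def
  proof (rule conv_radius_geI_ex')
    fix r :: real assume r: "0 < r" "ereal r < 1"
    have "1 \<le> fps_conv_radius (fps_expansion F 0)"
      using F by (intro conv_radius_fps_expansion) (simp add: one_ereal_def)
    with r(2) have "ereal r < fps_conv_radius (fps_expansion F 0)"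
      by (rule less_le_trans)
    then have "ereal (norm (of_real r :: complex)) < fps_conv_radius (fps_expansion F 0)"
      using r(1) by simp
    then have "summable (\<lambda>k. norm (b k * of_real r ^ k))"
      unfolding b_def by (rule norm_summable_fps)
    then show "summable (\<lambda>k. fps_nth f_fps k * of_real r ^ k)"
      by (rule summable_comparison_test') (simp add: norm_mult f_le mult_right_mono)
  qed
  then have f_hol: "f holomorphic_on ball 0 1"
    unfolding f_def by (intro holomorphic_on_eval_fps) (auto simp: ball_eball_mono one_ereal_def)
  have f_exp: "f has_fps_expansion f_fps"
    unfolding f_def using \<open>fps_conv_radius f_fps \<ge> 1\<close>
    by (intro eval_fps_has_fps_expansion) (auto intro: less_le_trans[of 0 1])
  have f_fps: "fps_expansion f 0 = f_fps" by (rule fps_expansion_eqI[OF f_exp])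
  have "f 0 = 0"
    by (simp add: f_def eval_fps_at_0 f_fps_def b0)
  moreover have "deriv f 0 = 1"
  proof -
    have "fps_nth (fps_expansion f 0) 1 = 1" unfolding f_fps using b1 by (simp add: f_fps_def)
    then show ?thesis by (simp add: fps_expansion_def)
  qed
  ultimately have "f \<in> class_A" using f_hol by (simp add: class_A_def)
  moreover have "lambda_mean lam f z = F z" if z: "z \<in> ball 0 1" for z
  proof -
    have L_hol: "lambda_mean lam f holomorphic_on ball 0 1"
      by (rule lambda_mean_holomorphic[OF f_hol])
    then have L_exp: "lambda_mean lam f has_fps_expansion fps_expansion (lambda_mean lam f) 0"
      by (auto intro!: has_fps_expansion_fps_expansion[of "ball 0 1"])
    have "fps_expansion (lambda_mean lam f) 0 = fps_expansion F 0"
    proof (rule fps_ext)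
      fix k
      show "fps_nth (fps_expansion (lambda_mean lam f) 0) k = fps_nth (fps_expansion F 0) k"
      proof (cases k)
        case 0
        then show ?thesis using F \<open>f 0 = 0\<close> by (simp add: fps_expansion_def lambda_mean_def)
      next
        case (Suc m)
        have "of_real (1 + lam * real m) \<noteq> (0 :: complex)"
          using den[of m] by (simp only: of_real_eq_0_iff)
        then show ?thesis
          using lambda_mean_taylor_coeff[OF f_hol, of lam m] unfolding Suc taylor_coeff_def f_fps
          by (simp add: f_fps_def b_def)
      qed
    qed
    then show ?thesis
      using has_fps_expansion_imp_eval_fps_eq[OF L_exp _ L_hol, of z]
        has_fps_expansion_imp_eval_fps_eq[OF F_exp _ F(1), of z] z by simp
  qed
  ultimately show ?thesis by blast
qed

section \<open>Extremal functions\<close>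

text \<open>
  For the Schwarz function \<open>z ^ m\<close> the relation says that the logarithmic derivative of \<open>F z / z\<close>
  is \<open>\<delta> * z ^ (m - 1) / (1 + B * z ^ m)\<close>, which is analytic in the disc. The exponential of a
  primitive solves it for all \<open>B\<close> at once, whereas the explicit solution
  \<open>z * (1 + B * z ^ m) powr (\<delta> / (m * B))\<close> needs a separate treatment of \<open>B = 0\<close>.
\<close>

lemma schwarz_relation_extremal_exists:
  fixes \<delta> :: complex and B :: real and m :: nat
  assumes "1 \<le> m" "\<bar>B\<bar> \<le> 1"
  shows "\<exists>F. F holomorphic_on ball 0 1 \<and> F 0 = 0 \<and> deriv F 0 = 1 \<and> (\<forall>z. z \<noteq> 0 \<longrightarrow> F z \<noteq> 0) \<and>
    (\<forall>z\<in>ball 0 1.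
        z * deriv F z - F z = z ^ m * (\<delta> * F z - of_real B * (z * deriv F z - F z)))"
proof -
  define q where "q = (\<lambda>z. \<delta> * z ^ (m - 1) / (1 + of_real B * z ^ m))"
  have nz: "1 + of_real B * z ^ m \<noteq> 0" if "z \<in> ball 0 1" for z :: complex
  proof -
    have "norm (z ^ m) < 1"
      using that assms by (simp add: norm_power power_less_one_iff)
    then show ?thesis using assms(2) by (rule one_plus_mult_nonzero)
  qed
  have "q holomorphic_on ball 0 1"
    unfolding q_def by (intro holomorphic_intros nz)
  then obtain h0 where h0: "\<And>z. z \<in> ball 0 1 \<Longrightarrow> (h0 has_field_derivative q z) (at z within ball 0 1)"
    using holomorphic_convex_primitive'[of "ball 0 1" q] by auto
  define h where "h = (\<lambda>z. h0 z - h0 0)"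
  have h: "(h has_field_derivative q z) (at z)" if "z \<in> ball 0 1" for z
    unfolding h_def using h0[OF that] at_within_open[OF that open_ball]
    by (auto intro!: derivative_eq_intros)
  define F where "F = (\<lambda>z. z * exp (h z))"
  have F_deriv: "(F has_field_derivative exp (h z) + z * (q z * exp (h z))) (at z)"
    if "z \<in> ball 0 1" for z
    unfolding F_def using h[OF that] by (auto intro!: derivative_eq_intros)
  note F_deriv' = DERIV_imp_deriv[OF F_deriv]
  show ?thesis
  proof (intro exI[of _ F] conjI allI impI ballI)
    show "F holomorphic_on ball 0 1"
      using F_deriv unfolding holomorphic_on_open[OF open_ball] by blast
    show "F 0 = 0" by (simp add: F_def)
    show "deriv F 0 = 1" using F_deriv'[of 0] by (simp add: h_def)
    show "F z \<noteq> 0" if "z \<noteq> 0" for z using that by (simp add: F_def)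
    show "z * deriv F z - F z = z ^ m * (\<delta> * F z - of_real B * (z * deriv F z - F z))"
      if z: "z \<in> ball 0 1" for z
    proof -
      define c where "c = 1 + of_real B * z ^ m"
      have zm: "z * z ^ (m - 1) = z ^ m" using assms by (simp flip: power_Suc)
      have D: "z * deriv F z - F z = z * q z * F z"
        unfolding F_deriv'[OF z] by (simp add: F_def algebra_simps)
      have "z * q z * c = \<delta> * z ^ m"
        using nz[OF z] by (simp add: q_def c_def zm[symmetric] mult_ac)
      then have "(z * q z * F z) * c = \<delta> * z ^ m * F z"
        by (simp add: mult_ac)
      then show ?thesis
        unfolding D c_def by (simp add: algebra_simps)
    qed
  qed
qed

text \<open>
  The recursion has step \<open>m\<close>. With \<open>m = 1\<close> it attains the product of the factors
  \<open>\<delta> - j * B\<close> at every index; with \<open>m = n - 1\<close> it jumps from the first coefficient directly to the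
  \<open>n\<close>-th, with the single factor \<open>\<delta>\<close>.
\<close>

lemma class_S_extremal_exists:
  fixes \<gamma> :: complex and lam A B :: real and m :: nat
  assumes "\<gamma> \<noteq> 0" "0 \<le> lam" "-1 \<le> B" "B < A" "A \<le> 1" and m: "1 \<le> m"
  defines "\<delta> \<equiv> \<gamma> * (of_real A - of_real B)"
  obtains f where "f \<in> class_S lam \<gamma> A B"
    "taylor_coeff (lambda_mean lam f) 1 = 1"
    "\<And>k. of_nat (k + m) * taylor_coeff (lambda_mean lam f) (Suc (k + m))
            = (\<delta> - of_nat k * of_real B) * taylor_coeff (lambda_mean lam f) (Suc k)"
proof -
  have B: "\<bar>B\<bar> \<le> 1" using assms by auto
  obtain F where F: "F holomorphic_on ball 0 1" "F 0 = 0" "deriv F 0 = 1"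
      "\<forall>z. z \<noteq> 0 \<longrightarrow> F z \<noteq> 0"
    and rel: "\<forall>z\<in>ball 0 1.
        z * deriv F z - F z = z ^ m * (\<delta> * F z - of_real B * (z * deriv F z - F z))"
    using schwarz_relation_extremal_exists[OF m B, of \<delta>] by blast
  obtain f where f: "f \<in> class_A" and L: "\<forall>z\<in>ball 0 1. lambda_mean lam f z = F z"
    using lambda_mean_surjective[OF F(1-3) \<open>0 \<le> lam\<close>] by blast
  define FF where "FF = fps_expansion F 0"
  have F_exp: "F has_fps_expansion FF"
    unfolding FF_def by (rule has_fps_expansion_fps_expansion[OF open_ball _ F(1)]) simp
  have L_ev: "eventually (\<lambda>x. lambda_mean lam f x = F x) (nhds z)" if "z \<in> ball 0 1" for z
    using eventually_nhds_in_open[OF open_ball that] by eventually_elim (rule L[rule_format])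
  have "lambda_mean lam f has_fps_expansion FF"
    using has_fps_expansion_cong[OF L_ev[of 0] refl] F_exp by simp
  then have coeff: "taylor_coeff (lambda_mean lam f) k = fps_nth FF k" for k
    by (simp only: taylor_coeff_def fps_expansion_eqI[of _ FF])
  show thesis
  proof
    have L_deriv: "deriv (lambda_mean lam f) z = deriv F z" if "z \<in> ball 0 1" for z
      by (rule deriv_cong_ev[OF L_ev[OF that] refl])
    have "(\<lambda>z::complex. z ^ m) ` ball 0 1 \<subseteq> ball 0 1"
      using m by (auto simp: norm_power power_less_one_iff)
    moreover have "(\<lambda>z::complex. z ^ m) holomorphic_on ball 0 1"
      by (intro holomorphic_intros)
    moreover have "(0::complex) ^ m = 0" using m by simp
    moreover have "\<forall>z\<in>unit_disc. z * deriv (lambda_mean lam f) z - lambda_mean lam f z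
           = z ^ m * (\<gamma> * (of_real A - of_real B) * lambda_mean lam f z
               - of_real B * (z * deriv (lambda_mean lam f) z - lambda_mean lam f z))"
      by (intro ballI) (simp only: L[rule_format] L_deriv, rule rel[unfolded \<delta>_def, rule_format])
    moreover have "\<forall>z\<in>unit_disc - {0}. lambda_mean lam f z \<noteq> 0"
      using F(4) L by simp
    ultimately show "f \<in> class_S lam \<gamma> A B"
      unfolding class_S_iff_schwarz_relation[OF \<open>\<gamma> \<noteq> 0\<close> \<open>-1 \<le> B\<close> \<open>B < A\<close> \<open>A \<le> 1\<close> f]
      by (intro conjI exI[of _ "\<lambda>z. z ^ m"])
  next
    show "taylor_coeff (lambda_mean lam f) 1 = 1"
      unfolding coeff using F(3) by (simp add: FF_def fps_expansion_def)
  next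
    fix k
    have "fps_X * fps_deriv FF - FF
           = fps_X ^ m * (fps_const \<delta> * FF - fps_const (of_real B) * (fps_X * fps_deriv FF - FF))"
      by (rule schwarz_relation_fps[OF F_exp has_fps_expansion_fps_X_power rel[rule_format]])
    then have "fps_nth (fps_X * fps_deriv FF - FF) (Suc (k + m))
           = fps_nth (fps_X ^ m * (fps_const \<delta> * FF - fps_const (of_real B) * (fps_X * fps_deriv FF - FF)))
               (Suc (k + m))"
      by (rule arg_cong)
    then show "of_nat (k + m) * taylor_coeff (lambda_mean lam f) (Suc (k + m))
            = (\<delta> - of_nat k * of_real B) * taylor_coeff (lambda_mean lam f) (Suc k)"
      unfolding coeff fps_X_power_mult_nth by (simp add: Suc_diff_le algebra_simps)
  qed
qed

section \<open>Coefficient bounds for the class\<close>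

lemma A_seq_Suc:
  "A_seq \<gamma> A B (Suc j) = norm (\<gamma> * (of_real A - of_real B) - of_nat j * of_real B) - real j"
  by (simp add: A_seq_def mult.commute)

text \<open>
  By the triangle inequality each step changes the norm by at most \<open>\<bar>B\<bar> \<le> 1\<close>, while the
  subtracted index grows by \<open>1\<close>. Hence a single sign condition on the sequence determines the signs
  of all earlier or all later terms.
\<close>

lemma A_seq_antimono:
  assumes "\<bar>B\<bar> \<le> 1" "i \<le> j"
  shows "A_seq \<gamma> A B (Suc j) \<le> A_seq \<gamma> A B (Suc i)"
  using assms(2)
proof (rule lift_Suc_antimono_le[of "\<lambda>j. A_seq \<gamma> A B (Suc j)", rotated])
  fix j
  let ?\<delta> = "\<gamma> * (of_real A - of_real B) :: complex"
  have "?\<delta> - of_nat (Suc j) * of_real B = (?\<delta> - of_nat j * of_real B) - of_real B"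
    by (simp add: algebra_simps)
  then have "norm (?\<delta> - of_nat (Suc j) * of_real B) \<le> norm (?\<delta> - of_nat j * of_real B) + \<bar>B\<bar>"
    by (simp only:) (use norm_triangle_ineq4[of "?\<delta> - of_nat j * of_real B" "of_real B"] in simp)
  then show "A_seq \<gamma> A B (Suc (Suc j)) \<le> A_seq \<gamma> A B (Suc j)"
    using assms(1) unfolding A_seq_Suc by simp
qed

text \<open>
  The number \<open>k\<close> counts the weights that contribute to the bound. All three estimates are instances:
  \<open>k = 1\<close> if only the first weight is used, \<open>k = n\<close> if all of them are, and the values in between.
\<close>

lemma class_S_coeff_bound:
  fixes \<gamma> :: complex and lam A B :: real and n k :: nat
  assumes "\<gamma> \<noteq> 0" "0 \<le> lam" "-1 \<le> B" "B < A" "A \<le> 1"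
    and f: "f \<in> class_S lam \<gamma> A B"
    and k: "1 \<le> k" "k \<le> n" "0 \<le> A_seq \<gamma> A B k" "k < n \<Longrightarrow> A_seq \<gamma> A B (Suc k) \<le> 0"
  shows "norm (taylor_coeff f (Suc n))
           \<le> (\<Prod>j<k. norm (\<gamma> * (of_real A - of_real B) - of_nat j * of_real B))
               / (fact (k - 1) * real n * (1 + lam * real n))"
proof -
  define F where "F = lambda_mean lam f"
  define e where "e = (\<lambda>j::nat. norm (\<gamma> * (of_real A - of_real B) - of_nat j * of_real B))"
  define y where "y = (\<lambda>j. norm (taylor_coeff F (Suc j)))"
  have B: "\<bar>B\<bar> \<le> 1" using assms by auto
  have fA: "f \<in> class_A" using f by (simp add: class_S_def)
  then have f_hol: "f holomorphic_on ball 0 1" and f1: "deriv f 0 = 1" "f 0 = 0"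
    by (simp_all add: class_A_def)
  obtain w where w: "w holomorphic_on unit_disc" "w ` unit_disc \<subseteq> unit_disc" "w 0 = 0"
    and rel: "\<And>z. z \<in> unit_disc \<Longrightarrow> z * deriv F z - F z
           = w z * (\<gamma> * (of_real A - of_real B) * F z - of_real B * (z * deriv F z - F z))"
    using f unfolding F_def
      class_S_iff_schwarz_relation[OF \<open>\<gamma> \<noteq> 0\<close> \<open>-1 \<le> B\<close> \<open>B < A\<close> \<open>A \<le> 1\<close> fA] by blast
  have F: "F holomorphic_on ball 0 1" "F 0 = 0"
    unfolding F_def using lambda_mean_holomorphic[OF f_hol] f1 by (simp_all add: lambda_mean_def)
  have coeff: "y j = (1 + lam * real j) * norm (taylor_coeff f (Suc j))" for j
    unfolding y_def F_def lambda_mean_taylor_coeff[OF f_hol] norm_mult norm_of_real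
    using \<open>0 \<le> lam\<close> by simp
  have "real n * y n \<le> (\<Prod>j<k. e j) / fact (k - 1)"
  proof (rule coeff_bound_of_square_inequality)
    show "y 0 = 1"
      unfolding coeff using f1 by (simp add: taylor_coeff_def fps_expansion_def)
    show "0 \<le> y j" "0 \<le> e j" for j by (simp_all add: y_def e_def)
    show "(real i * y i)\<^sup>2 \<le> (\<Sum>j<i. ((e j)\<^sup>2 - (real j)\<^sup>2) * (y j)\<^sup>2)" for i
      unfolding y_def e_def taylor_coeff_def
      by (rule schwarz_relation_coeff_inequality[OF w F rel])
    show "1 \<le> k" "k \<le> n" by fact+
    show "real j \<le> e j" if "j < k" for j
    proof -
      have "j \<le> k - 1" using that by simp
      from A_seq_antimono[OF B this, of \<gamma> A] show ?thesis
        using k(1,3) by (simp add: A_seq_Suc e_def)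
    qed
    show "e j \<le> real j" if "k \<le> j" "j < n" for j
      using A_seq_antimono[OF B that(1), of \<gamma> A] k(4) that by (simp add: A_seq_Suc e_def)
  qed
  moreover have "0 < real n * (1 + lam * real n)"
    using k \<open>0 \<le> lam\<close> by (auto intro!: mult_pos_pos add_pos_nonneg)
  ultimately have "norm (taylor_coeff f (Suc n))
      \<le> (\<Prod>j<k. e j) / fact (k - 1) / (real n * (1 + lam * real n))"
    by (simp only: pos_le_divide_eq coeff mult_ac)
  then show ?thesis
    by (simp add: e_def mult_ac)
qed

theorem theorem2p1:
  fixes \<gamma> :: complex and lam A B :: real and n :: nat
  assumes "\<gamma> \<noteq> 0" and "0 \<le> lam" and "lam \<le> 1"
    and "-1 \<le> B" and "B < A" and "A \<le> 1" and "2 \<le> n"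
  shows
    "(\<forall>f \<in> class_S lam \<gamma> A B.
        (A_seq \<gamma> A B 2 \<le> 0 \<longrightarrow>
           norm (taylor_coeff f n)
             \<le> norm \<gamma> * (A - B) / ((real n - 1) * (1 + lam * (real n - 1)))) \<and>
        (A_seq \<gamma> A B (n - 1) \<ge> 0 \<longrightarrow>
           norm (taylor_coeff f n)
             \<le> (\<Prod>j=0..n-2. norm (\<gamma> * (of_real A - of_real B) - of_nat j * of_real B))
                 / (fact (n - 1) * (1 + lam * (real n - 1)))) \<and>
        (\<forall>k\<in>{2..n-2}. A_seq \<gamma> A B k \<ge> 0 \<and> A_seq \<gamma> A B (k + 1) \<le> 0 \<longrightarrow>
           norm (taylor_coeff f n)
             \<le> (\<Prod>j=0..k-1. norm (\<gamma> * (of_real A - of_real B) - of_nat j * of_real B))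
                 / (fact (k - 1) * (real n - 1) * (1 + lam * (real n - 1)))))
     \<and> (A_seq \<gamma> A B 2 \<le> 0 \<longrightarrow>
          (\<exists>f \<in> class_S lam \<gamma> A B.
             norm (taylor_coeff f n)
               = norm \<gamma> * (A - B) / ((real n - 1) * (1 + lam * (real n - 1)))))
     \<and> (A_seq \<gamma> A B (n - 1) \<ge> 0 \<longrightarrow>
          (\<exists>f \<in> class_S lam \<gamma> A B.
             norm (taylor_coeff f n)
               = (\<Prod>j=0..n-2. norm (\<gamma> * (of_real A - of_real B) - of_nat j * of_real B))
                   / (fact (n - 1) * (1 + lam * (real n - 1)))))"
proof -
  define \<delta> where "\<delta> = \<gamma> * (of_real A - of_real B)"
  define N where "N = n - 1"
  have n: "n = Suc N" "1 \<le> N" "real n - 1 = real N" using \<open>2 \<le> n\<close> by (auto simp: N_def)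
  have norm_\<delta>: "norm \<delta> = norm \<gamma> * (A - B)"
    unfolding \<delta>_def norm_mult of_real_diff[symmetric] norm_of_real using \<open>B < A\<close> by simp
  have prod_range: "(\<Prod>j=0..k-1. g j) = (\<Prod>j<k. g j)" if "1 \<le> k" for k and g :: "nat \<Rightarrow> real"
    using that by (intro prod.cong) auto
  have fact_N: "fact N = fact (N - 1) * real N"
    using n(2) by (simp add: fact_reduce mult.commute)
  note bound = class_S_coeff_bound[OF assms(1,2,4-6), folded \<delta>_def, where n = N]
  have upper1: "norm (taylor_coeff f n) \<le> norm \<gamma> * (A - B) / (real N * (1 + lam * real N))"
    if "f \<in> class_S lam \<gamma> A B" "A_seq \<gamma> A B 2 \<le> 0" for f
    using bound[OF that(1), of 1] that(2) n(2)
    by (simp add: n(1) A_seq_def numeral_2_eq_2 norm_\<delta>)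
  have upper2: "norm (taylor_coeff f n)
      \<le> (\<Prod>j=0..n-2. norm (\<delta> - of_nat j * of_real B)) / (fact N * (1 + lam * real N))"
    if "f \<in> class_S lam \<gamma> A B" "0 \<le> A_seq \<gamma> A B N" for f
    using bound[OF that(1), of N] that(2) n(2) prod_range[of N] by (simp add: n(1) fact_N)
  have upper3: "norm (taylor_coeff f n)
      \<le> (\<Prod>j=0..k-1. norm (\<delta> - of_nat j * of_real B)) / (fact (k - 1) * real N * (1 + lam * real N))"
    if "f \<in> class_S lam \<gamma> A B" "k \<in> {2..n-2}" "0 \<le> A_seq \<gamma> A B k" "A_seq \<gamma> A B (k + 1) \<le> 0" for f k
  proof -
    have "1 \<le> k" "k \<le> N" using that(2) by (auto simp: n(1))
    then show ?thesis
      using bound[OF that(1), of k] that(3,4) prod_range[of k] by (simp add: n(1))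
  qed
  have taylor: "taylor_coeff f n = taylor_coeff (lambda_mean lam f) n / of_real (1 + lam * real N)"
    if "f \<in> class_S lam \<gamma> A B" for f
  proof -
    have "1 + lam * real N > 0" using \<open>0 \<le> lam\<close> by (intro add_pos_nonneg) auto
    then have "of_real (1 + lam * real N) \<noteq> (0 :: complex)" by (simp only: of_real_eq_0_iff)
    moreover have "f holomorphic_on ball 0 1"
      using that by (simp add: class_S_def class_A_def)
    ultimately show ?thesis
      using lambda_mean_taylor_coeff[of f lam N] n(1) by (simp add: field_simps)
  qed
  have sharp1: "\<exists>f \<in> class_S lam \<gamma> A B.
      norm (taylor_coeff f n) = norm \<gamma> * (A - B) / (real N * (1 + lam * real N))"
  proof -
    obtain f where f: "f \<in> class_S lam \<gamma> A B" "taylor_coeff (lambda_mean lam f) 1 = 1"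
      "\<And>k. of_nat (k + N) * taylor_coeff (lambda_mean lam f) (Suc (k + N))
            = (\<delta> - of_nat k * of_real B) * taylor_coeff (lambda_mean lam f) (Suc k)"
      using class_S_extremal_exists[OF assms(1,2,4-6) n(2), folded \<delta>_def] by metis
    have "taylor_coeff (lambda_mean lam f) n = \<delta> / of_nat N"
      using f(3)[of 0] f(2) n(2) by (simp add: n(1) field_simps)
    then have "norm (taylor_coeff f n) = norm \<delta> / (real N * (1 + lam * real N))"
      unfolding taylor[OF f(1)] norm_divide norm_of_real using \<open>0 \<le> lam\<close> by (simp add: norm_divide)
    then show ?thesis using f(1) norm_\<delta> by auto
  qed
  have sharp2: "\<exists>f \<in> class_S lam \<gamma> A B. norm (taylor_coeff f n)
      = (\<Prod>j=0..n-2. norm (\<delta> - of_nat j * of_real B)) / (fact N * (1 + lam * real N))"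
  proof -
    obtain f where f: "f \<in> class_S lam \<gamma> A B" "taylor_coeff (lambda_mean lam f) 1 = 1"
      "\<And>k. of_nat (k + 1) * taylor_coeff (lambda_mean lam f) (Suc (k + 1))
            = (\<delta> - of_nat k * of_real B) * taylor_coeff (lambda_mean lam f) (Suc k)"
      using class_S_extremal_exists[OF assms(1,2,4-6) order_refl, folded \<delta>_def] by metis
    have coeff: "taylor_coeff (lambda_mean lam f) (Suc i) = (\<Prod>j<i. \<delta> - of_nat j * of_real B) / fact i" for i
    proof (induction i)
      case 0
      then show ?case using f(2) by simp
    next
      case (Suc i)
      have "taylor_coeff (lambda_mean lam f) (Suc (Suc i))
              = (\<delta> - of_nat i * of_real B) * taylor_coeff (lambda_mean lam f) (Suc i) / of_nat (Suc i)"
        using f(3)[of i] by (simp add: nonzero_eq_divide_eq mult.commute del: of_nat_Suc)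
      then show ?case
        unfolding Suc.IH by (simp add: mult_ac del: of_nat_Suc)
    qed
    have "norm (taylor_coeff (lambda_mean lam f) n) = (\<Prod>j<N. norm (\<delta> - of_nat j * of_real B)) / fact N"
      unfolding n(1) coeff by (simp add: norm_divide prod_norm)
    also have "(\<Prod>j<N. norm (\<delta> - of_nat j * of_real B)) = (\<Prod>j=0..n-2. norm (\<delta> - of_nat j * of_real B))"
      using prod_range[OF n(2)] by (simp add: n(1))
    finally have "norm (taylor_coeff f n)
        = (\<Prod>j=0..n-2. norm (\<delta> - of_nat j * of_real B)) / (fact N * (1 + lam * real N))"
      unfolding taylor[OF f(1)] norm_divide norm_of_real using \<open>0 \<le> lam\<close> by simp
    then show ?thesis using f(1) by (rule bexI)
  qed
  show ?thesis
    unfolding n(3) \<delta>_def[symmetric] N_def[symmetric]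
  proof (intro conjI ballI impI, goal_cases)
    case (1 f)
    then show ?case by (rule upper1)
  next
    case (2 f)
    then show ?case by (rule upper2)
  next
    case (3 f k)
    then show ?case using upper3[of f k] by (elim conjE)
  next
    case 4
    show ?case by (rule sharp1)
  next
    case 5
    show ?case by (rule sharp2)
  qed
qed

end
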